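(* Let $m,n$ be positive integers and let $\mathcal{A}=(a_{ijkl})$ be an $m\times n$ diagonally dominated symmetric biquadratic tensor. Then $\mathcal{A}$ is an SOS tensor, i.e. the associated biquadratic form $$P(\mathbf{x},\mathbf{y})=\sum_{i,k=1}^m\sum_{j,l=1}^n a_{ijkl}\,x_i y_j x_k y_l,\qquad \mathbf{x}\in\mathbb{R}^m,\ \mathbf{y}\in\mathbb{R}^n,$$ can be written as $P(\mathbf{x},\mathbf{y})=\sum_{p=1}^r f_p(\mathbf{x},\mathbf{y})^2$ for some finite $r$ and some real bilinear forms $f_1,\dots,f_r$ in $(\mathbf{x},\mathbf{y})$.
   Context: Write $[m]=\{1,\dots,m\}$. An $m\times n$ biquadratic tensor is an array $\mathcal{A}=(a_{ijkl})$ of real numbers indexed by $i,k\in[m]$, $j,l\in[n]$. It is symmetric if $a_{ijkl}=a_{kjil}=a_{klij}$ for all $i,k\in[m]$, $j,l\in[n]$. The diagonal entries are the $a_{ijij}$; all other entries are off-diagonal. Put $\bar a_{ijkl}=0$ if $(i,j)=(k,l)$ and $\bar a_{ijkl}=a_{ijkl}$ otherwise. The tensor $\mathcal{A}$ is called diagonally dominated if for all $i\in[m]$, $j\in[n]$, $$a_{ijij}\ \ge\ \frac12\sum_{i_2=1}^m\left(\sum_{j_2=1}^n\left|\bar a_{iji_2j_2}\right|+\sum_{j_1=1}^n\left|\bar a_{ij_1i_2j}\right|\right).$$ A bilinear form in $(\mathbf{x},\mathbf{y})$ is a polynomial $\sum_{i=1}^m\sum_{j=1}^n w_{ij}x_iy_j$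 with $w_{ij}\in\mathbb{R}$. *)

theory Defs
  imports "HOL-Analysis.Analysis"
begin

text \<open>
  The index sets [m] and [n] are finite types \<open>'m\<close> and \<open>'n\<close>, with m and n the cardinalities
  \<open>CARD('m)\<close> and \<open>CARD('n)\<close>; types are nonempty, so both are positive.
  The entry \<open>a\<^sub>i\<^sub>j\<^sub>k\<^sub>l\<close> is \<open>a i j k l\<close>.
\<close>

type_synonym ('m, 'n) biquadratic_tensor = "'m \<Rightarrow> 'n \<Rightarrow> 'm \<Rightarrow> 'n \<Rightarrow> real"

definition symmetric_tensor :: "('m::finite, 'n::finite) biquadratic_tensor \<Rightarrow> bool" where
  "symmetric_tensor a \<longleftrightarrow>
     (\<forall>i j k l. a i j k l = a k j i l \<and> a k j i l = a k l i j)"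

definition off_diagonal :: "('m::finite, 'n::finite) biquadratic_tensor \<Rightarrow> ('m, 'n) biquadratic_tensor" where
  "off_diagonal a = (\<lambda>i j k l. if (i, j) = (k, l) then 0 else a i j k l)"

definition diagonally_dominated :: "('m::finite, 'n::finite) biquadratic_tensor \<Rightarrow> bool" where
  "diagonally_dominated a \<longleftrightarrow>
     (\<forall>i j. a i j i j \<ge>
        (1/2) * (\<Sum>i2\<in>UNIV. (\<Sum>j2\<in>UNIV. \<bar>off_diagonal a i j i2 j2\<bar>)
                           + (\<Sum>j1\<in>UNIV. \<bar>off_diagonal a i j1 i2 j\<bar>)))"

definition biquadratic_form ::
    "('m::finite, 'n::finite) biquadratic_tensor \<Rightarrow> real ^ 'm \<Rightarrow> real ^ 'n \<Rightarrow> real" where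
  "biquadratic_form a x y =
     (\<Sum>i\<in>UNIV. \<Sum>k\<in>UNIV. \<Sum>j\<in>UNIV. \<Sum>l\<in>UNIV. a i j k l * x $ i * y $ j * x $ k * y $ l)"

text \<open>
  Forms are represented by the functions they induce: over the infinite field of reals a
  polynomial is determined by its values.
\<close>

definition is_bilinear_form :: "(real ^ 'm::finite \<Rightarrow> real ^ 'n::finite \<Rightarrow> real) \<Rightarrow> bool" where
  "is_bilinear_form f \<longleftrightarrow>
     (\<exists>w :: 'm \<Rightarrow> 'n \<Rightarrow> real. \<forall>x y. f x y = (\<Sum>i\<in>UNIV. \<Sum>j\<in>UNIV. w i j * x $ i * y $ j))"

definition sos_tensor :: "('m::finite, 'n::finite) biquadratic_tensor \<Rightarrow> bool" where
  "sos_tensor a \<longleftrightarrow>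
     (\<exists>(r::nat) (f :: nat \<Rightarrow> real ^ 'm \<Rightarrow> real ^ 'n \<Rightarrow> real).
        (\<forall>p\<in>{1..r}. is_bilinear_form (f p)) \<and>
        (\<forall>x y. biquadratic_form a x y = (\<Sum>p=1..r. (f p x y)\<^sup>2)))"

end

theory Submission imports Defs begin

text \<open>
  In the products \<open>z\<^sub>i\<^sub>j = x\<^sub>i y\<^sub>j\<close> the form \<open>P\<close> is an ordinary quadratic form, whose matrix has rows and
  columns indexed by pairs and the entry \<open>a\<^sub>i\<^sub>j\<^sub>k\<^sub>l\<close> in row \<open>(i, j)\<close> and column \<open>(k, l)\<close>.
  The symmetries of the tensor make this matrix symmetric, and they also give
  \<open>a\<^sub>i\<^sub>j\<^sub>k\<^sub>l = a\<^sub>i\<^sub>l\<^sub>k\<^sub>j\<close>, so that the two sums in the definition of diagonal dominance are equal.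
  Their mean is the plain off-diagonal absolute row sum: the tensor is diagonally dominated exactly
  when the matrix is diagonally dominant in the usual sense.

  A symmetric, diagonally dominant matrix \<open>M\<close> with row slacks
  \<open>d\<^sub>p = M\<^sub>p\<^sub>p - (\<Sum>q\<noteq>p. \<bar>M\<^sub>p\<^sub>q\<bar>) \<ge> 0\<close> has a quadratic form that is visibly a sum of squares
  (lemma \<open>diagonally_dominant_quadratic_form_sos\<close>):
  \[ \sum_{p,q} M_{pq} z_p z_q
      = \sum_p d_p z_p^2 + \frac12 \sum_{p \neq q} |M_{pq}| (z_p + \mathrm{sgn}(M_{pq}) z_q)^2 . \]
  Each linear form in \<open>z\<close> is a bilinear form in \<open>(x, y)\<close>, so substituting
  \<open>z\<^sub>i\<^sub>j = x\<^sub>i y\<^sub>j\<close> gives the decomposition of \<open>P\<close>.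
\<close>

lemma sum_UNIV_prod:
  fixes g :: "'a::finite \<times> 'b::finite \<Rightarrow> real"
  shows "(\<Sum>p\<in>UNIV. g p) = (\<Sum>i\<in>UNIV. \<Sum>j\<in>UNIV. g (i, j))"
  by (simp add: sum.cartesian_product)

text \<open>
  The squares are indexed by all pairs \<open>(p, q)\<close>: a diagonal pair carries the slack of row \<open>p\<close>, and
  an off-diagonal pair carries the term that accounts for the entry \<open>M p q\<close>.  Each off-diagonal
  pair contributes half of \<open>\<bar>M p q\<bar>\<close> to both \<open>(z p)\<^sup>2\<close> and \<open>(z q)\<^sup>2\<close>; by symmetry of \<open>M\<close> the
  contributions to \<open>(z p)\<^sup>2\<close> add up to the off-diagonal row sum, which the slack completes to
  \<open>M p p\<close>.
\<close>

lemma diagonally_dominant_quadratic_form_sos: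
  fixes M :: "'p::finite \<Rightarrow> 'p \<Rightarrow> real"
  assumes sym: "\<And>p q. M p q = M q p"
    and dom: "\<And>p. (\<Sum>q\<in>UNIV. if p = q then 0 else \<bar>M p q\<bar>) \<le> M p p"
  shows "\<exists>w :: 'p \<times> 'p \<Rightarrow> 'p \<Rightarrow> real. \<forall>z.
    (\<Sum>p\<in>UNIV. \<Sum>q\<in>UNIV. M p q * z p * z q) = (\<Sum>s\<in>UNIV. (\<Sum>t\<in>UNIV. w s t * z t)\<^sup>2)"
proof -
  define N where "N p q = (if p = q then 0 else M p q)" for p q
  define d where "d p = M p p - (\<Sum>q\<in>UNIV. \<bar>N p q\<bar>)" for p
  define w where "w = (\<lambda>(p, q) t.
    if p = q then of_bool (t = p) * sqrt (d p)
    else sqrt (\<bar>M p q\<bar> / 2) * (of_bool (t = p) + sgn (M p q) * of_bool (t = q)))"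
  have N_sym: "N p q = N q p" for p q
    using sym by (simp add: N_def)
  have "(\<Sum>q\<in>UNIV. \<bar>N p q\<bar>) = (\<Sum>q\<in>UNIV. if p = q then 0 else \<bar>M p q\<bar>)" for p
    by (rule sum.cong) (auto simp: N_def)
  then have d_nonneg: "d p \<ge> 0" for p
    using dom[of p] by (simp add: d_def)
  have "(\<Sum>p\<in>UNIV. \<Sum>q\<in>UNIV. M p q * z p * z q) = (\<Sum>s\<in>UNIV. (\<Sum>t\<in>UNIV. w s t * z t)\<^sup>2)" for z
  proof -
    have square: "(\<Sum>t\<in>UNIV. w (p, q) t * z t)\<^sup>2 =
        of_bool (p = q) * (d p * (z p)\<^sup>2)
        + (\<bar>N p q\<bar> / 2 * (z p)\<^sup>2 + \<bar>N q p\<bar> / 2 * (z q)\<^sup>2 + N p q * z p * z q)" for p q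
    proof (cases "p = q")
      case True
      then have "(\<Sum>t\<in>UNIV. w (p, q) t * z t) = sqrt (d p) * z p"
        by (simp add: w_def if_distrib[of "\<lambda>u. u * _"] of_bool_def cong: if_cong)
      with True d_nonneg[of p] show ?thesis
        by (simp add: N_def power_mult_distrib)
    next
      case False
      have "(\<Sum>t\<in>UNIV. w (p, q) t * z t) =
          sqrt (\<bar>M p q\<bar> / 2) * ((\<Sum>t\<in>UNIV. of_bool (t = p) * z t)
            + sgn (M p q) * (\<Sum>t\<in>UNIV. of_bool (t = q) * z t))"
        using False unfolding sum_distrib_left sum.distrib[symmetric]
        by (intro sum.cong) (simp_all add: w_def algebra_simps)
      also have "\<dots> = sqrt (\<bar>M p q\<bar> / 2) * (z p + sgn (M p q) * z q)"
        by (simp add: of_bool_def if_distrib[of "\<lambda>u. u * _"] cong: if_cong)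
      finally have "(\<Sum>t\<in>UNIV. w (p, q) t * z t)\<^sup>2 =
          \<bar>M p q\<bar> / 2 * (z p + sgn (M p q) * z q)\<^sup>2"
        by (simp add: power_mult_distrib)
      with False sym[of q p] show ?thesis
        by (cases "M p q" "0 :: real" rule: linorder_cases)
          (simp_all add: N_def power2_eq_square field_simps)
    qed
    have "(\<Sum>s\<in>UNIV. (\<Sum>t\<in>UNIV. w s t * z t)\<^sup>2)
        = (\<Sum>p\<in>UNIV. \<Sum>q\<in>UNIV. (\<Sum>t\<in>UNIV. w (p, q) t * z t)\<^sup>2)"
      by (rule sum_UNIV_prod)
    also have "\<dots> = (\<Sum>p\<in>UNIV. \<Sum>q\<in>UNIV. of_bool (p = q) * (d p * (z p)\<^sup>2))
        + (\<Sum>p\<in>UNIV. \<Sum>q\<in>UNIV. \<bar>N p q\<bar> / 2 * (z p)\<^sup>2)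
        + (\<Sum>p\<in>UNIV. \<Sum>q\<in>UNIV. \<bar>N q p\<bar> / 2 * (z q)\<^sup>2)
        + (\<Sum>p\<in>UNIV. \<Sum>q\<in>UNIV. N p q * z p * z q)"
      unfolding square by (simp only: sum.distrib add.assoc)
    also have "(\<Sum>p\<in>UNIV. \<Sum>q\<in>UNIV. \<bar>N q p\<bar> / 2 * (z q)\<^sup>2)
        = (\<Sum>p\<in>UNIV. \<Sum>q\<in>UNIV. \<bar>N p q\<bar> / 2 * (z p)\<^sup>2)"
      by (rule sum.swap)
    also have "(\<Sum>p\<in>UNIV. \<Sum>q\<in>UNIV. of_bool (p = q) * (d p * (z p)\<^sup>2)) = (\<Sum>p\<in>UNIV. d p * (z p)\<^sup>2)"
      by (simp add: of_bool_def if_distrib[of "\<lambda>u. u * _"] cong: if_cong)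
    also have "(\<Sum>p\<in>UNIV. d p * (z p)\<^sup>2) + (\<Sum>p\<in>UNIV. \<Sum>q\<in>UNIV. \<bar>N p q\<bar> / 2 * (z p)\<^sup>2)
          + (\<Sum>p\<in>UNIV. \<Sum>q\<in>UNIV. \<bar>N p q\<bar> / 2 * (z p)\<^sup>2)
          + (\<Sum>p\<in>UNIV. \<Sum>q\<in>UNIV. N p q * z p * z q)
        = (\<Sum>p\<in>UNIV. M p p * (z p)\<^sup>2 + (\<Sum>q\<in>UNIV. N p q * z p * z q))"
    proof -
      have "d p * (z p)\<^sup>2 + (\<Sum>q\<in>UNIV. \<bar>N p q\<bar> / 2 * (z p)\<^sup>2) + (\<Sum>q\<in>UNIV. \<bar>N p q\<bar> / 2 * (z p)\<^sup>2)
          = M p p * (z p)\<^sup>2" for p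
        unfolding sum_distrib_right[symmetric] sum_divide_distrib[symmetric] d_def
        by (simp add: algebra_simps)
      then show ?thesis
        by (simp only: sum.distrib[symmetric])
    qed
    also have "\<dots> = (\<Sum>p\<in>UNIV. \<Sum>q\<in>UNIV. M p q * z p * z q)"
    proof (rule sum.cong[OF refl])
      fix p
      have "M p p * (z p)\<^sup>2 = (\<Sum>q\<in>UNIV. if p = q then M p p * z p * z p else 0)"
        by (simp add: power2_eq_square)
      then show "M p p * (z p)\<^sup>2 + (\<Sum>q\<in>UNIV. N p q * z p * z q) = (\<Sum>q\<in>UNIV. M p q * z p * z q)"
        by (simp only: sum.distrib[symmetric]) (auto simp: N_def intro!: sum.cong)
    qed
    finally show ?thesis by simp
  qed
  then show ?thesis by blast
qed

lemma sos_tensor_of_finite_family: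
  fixes a :: "('m::finite, 'n::finite) biquadratic_tensor"
  assumes "finite S"
    and bilinear: "\<And>s. s \<in> S \<Longrightarrow> is_bilinear_form (F s)"
    and form: "\<And>x y. biquadratic_form a x y = (\<Sum>s\<in>S. (F s x y)\<^sup>2)"
  shows "sos_tensor a"
proof -
  obtain h where h: "bij_betw h {1..card S} S"
    using ex_bij_betw_nat_finite_1[OF \<open>finite S\<close>] by blast
  have "is_bilinear_form (F (h p))" if "p \<in> {1..card S}" for p
    using bilinear bij_betwE[OF h] that by blast
  moreover have "biquadratic_form a x y = (\<Sum>p=1..card S. (F (h p) x y)\<^sup>2)" for x y
    using form sum.reindex_bij_betw[OF h, of "\<lambda>s. (F s x y)\<^sup>2"] by simp
  ultimately show ?thesis
    unfolding sos_tensor_def by (intro exI[of _ "card S"] exI[of _ "\<lambda>p. F (h p)"]) auto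
qed

definition pair_matrix :: "('m::finite, 'n::finite) biquadratic_tensor \<Rightarrow> 'm \<times> 'n \<Rightarrow> 'm \<times> 'n \<Rightarrow> real"
  where "pair_matrix a p q = a (fst p) (snd p) (fst q) (snd q)"

lemma biquadratic_form_eq_pair_matrix:
  "biquadratic_form a x y = (\<Sum>p\<in>UNIV. \<Sum>q\<in>UNIV.
     pair_matrix a p q * (x $ fst p * y $ snd p) * (x $ fst q * y $ snd q))"
proof -
  have "biquadratic_form a x y =
      (\<Sum>i\<in>UNIV. \<Sum>j\<in>UNIV. \<Sum>k\<in>UNIV. \<Sum>l\<in>UNIV. a i j k l * x $ i * y $ j * x $ k * y $ l)"
    unfolding biquadratic_form_def by (rule sum.cong[OF refl], rule sum.swap)
  then show ?thesis
    by (simp add: sum_UNIV_prod pair_matrix_def mult.assoc)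
qed

text \<open>
  For a symmetric tensor, exchanging \<open>j\<close> and \<open>l\<close> fixes \<open>a i j k l\<close> and preserves the condition
  \<open>(i, j) = (k, l)\<close>.  Hence the two sums in the dominance condition have the same terms, and the
  factor 1/2 averages two copies of the off-diagonal row sum.
\<close>

lemma pair_matrix_diagonally_dominant:
  assumes sym: "symmetric_tensor a" and dom: "diagonally_dominated a"
  shows "(\<Sum>q\<in>UNIV. if p = q then 0 else \<bar>pair_matrix a p q\<bar>) \<le> pair_matrix a p p"
proof -
  obtain i j where p: "p = (i, j)" by (cases p)
  have "a i l k j = a i j k l" for k l
    using sym unfolding symmetric_tensor_def by metis
  then have exchange: "off_diagonal a i l k j = off_diagonal a i j k l" for k l
    by (auto simp: off_diagonal_def)
  have "(\<Sum>q\<in>UNIV. if p = q then 0 else \<bar>pair_matrix a p q\<bar>)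
      = (\<Sum>(k, l)\<in>UNIV. \<bar>off_diagonal a i j k l\<bar>)"
    by (rule sum.cong) (auto simp: p off_diagonal_def pair_matrix_def split: if_splits)
  also have "\<dots> = (\<Sum>k\<in>UNIV. \<Sum>l\<in>UNIV. \<bar>off_diagonal a i j k l\<bar>)"
    by (simp add: sum_UNIV_prod)
  also have "\<dots> = (1/2) * (\<Sum>k\<in>UNIV. (\<Sum>l\<in>UNIV. \<bar>off_diagonal a i j k l\<bar>)
      + (\<Sum>l\<in>UNIV. \<bar>off_diagonal a i l k j\<bar>))"
    by (simp only: exchange sum.distrib) simp
  also have "\<dots> \<le> a i j i j"
    using dom unfolding diagonally_dominated_def by blast
  finally show ?thesis
    by (simp add: p pair_matrix_def)
qed

theorem theorem2p1:
  fixes a :: "('m::finite, 'n::finite) biquadratic_tensor"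
  assumes "symmetric_tensor a"
    and "diagonally_dominated a"
  shows "sos_tensor a"
proof -
  have "pair_matrix a p q = pair_matrix a q p" for p q
    using assms(1) unfolding symmetric_tensor_def pair_matrix_def by metis
  then have "\<exists>w :: ('m \<times> 'n) \<times> ('m \<times> 'n) \<Rightarrow> 'm \<times> 'n \<Rightarrow> real. \<forall>z.
      (\<Sum>p\<in>UNIV. \<Sum>q\<in>UNIV. pair_matrix a p q * z p * z q)
      = (\<Sum>s\<in>UNIV. (\<Sum>t\<in>UNIV. w s t * z t)\<^sup>2)"
    by (intro diagonally_dominant_quadratic_form_sos pair_matrix_diagonally_dominant[OF assms])
  then obtain w :: "('m \<times> 'n) \<times> ('m \<times> 'n) \<Rightarrow> 'm \<times> 'n \<Rightarrow> real"
    where w: "\<And>z. (\<Sum>p\<in>UNIV. \<Sum>q\<in>UNIV. pair_matrix a p q * z p * z q)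
      = (\<Sum>s\<in>UNIV. (\<Sum>t\<in>UNIV. w s t * z t)\<^sup>2)"
    by blast
  define F where "F s x y = (\<Sum>t\<in>UNIV. w s t * (x $ fst t * y $ snd t))"
    for s and x :: "real ^ 'm" and y :: "real ^ 'n"
  show ?thesis
  proof (rule sos_tensor_of_finite_family)
    show "finite (UNIV :: (('m \<times> 'n) \<times> ('m \<times> 'n)) set)" by simp
    show "is_bilinear_form (F s)" for s
      unfolding is_bilinear_form_def F_def
      by (rule exI[of _ "\<lambda>i j. w s (i, j)"])
        (simp add: sum_UNIV_prod mult.assoc)
    show "biquadratic_form a x y = (\<Sum>s\<in>UNIV. (F s x y)\<^sup>2)" for x y
      using w[of "\<lambda>p. x $ fst p * y $ snd p"]
      by (simp add: biquadratic_form_eq_pair_matrix F_def)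
  qed
qed

end
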